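(* Let $\omega\in\mathbb C$. There exists a unique algebra homomorphism $\zeta\colon \mathfrak K_\omega\to \mathrm U(\mathfrak{sl}_2)$ that sends $$A\mapsto \tfrac{1+\omega}{2}E+\tfrac{1-\omega}{2}F-\tfrac{\omega}{2}H,\qquad B\mapsto \tfrac12 H,\qquad C\mapsto -\tfrac{1+\omega}{2}E+\tfrac{1-\omega}{2}F.$$ Moreover, if $\omega^2\neq 1$, then $\zeta$ is an isomorphism and its inverse sends $$E\mapsto \tfrac{1}{1+\omega}A+\tfrac{\omega}{1+\omega}B-\tfrac{1}{1+\omega}C,\qquad F\mapsto \tfrac{1}{1-\omega}A+\tfrac{\omega}{1-\omega}B+\tfrac{1}{1-\omega}C,\qquad H\mapsto 2B.$$
   Context: All algebras are unital associative over $\mathbb C$ and $[x,y]=xy-yx$. $\mathrm U(\mathfrak{sl}_2)$ is the algebra generated by $E,F,H$ subject to $[H,E]=2E$, $[H,F]=-2F$, $[E,F]=H$. For $\omega\in\mathbb C$, the Krawtchouk algebra $\mathfrak K_\omega$ is the algebra generated by $A,B$ subject to $A^2B-2ABA+BA^2=B+\omega A$ and $B^2A-2BAB+AB^2=A+\omega B$; in it, $C:=[A,B]$. *)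

theory Defs
  imports Complex_Main "HOL-Library.Poly_Mapping" "HOL-Library.FuncSet" "HOL-Algebra.QuotRing" "HOL-Algebra.Module"
begin

datatype 'x word = Word "'x list"

instantiation word :: (type) monoid_add
begin

definition zero_word :: "'a word" where
  "0 = Word []"

fun plus_word :: "'a word \<Rightarrow> 'a word \<Rightarrow> 'a word" where
  "Word u + Word v = Word (u @ v)"

instance
proof
  fix a b c :: "'a word"
  show "a + b + c = a + (b + c)" by (cases a; cases b; cases c) simp
  show "0 + a = a" "a + 0 = a" by (cases a; simp add: zero_word_def)+
qed

end

text \<open>
  The additive monoid of words is concatenation, so the convolution product on
  finitely supported functions on words is the product of noncommutative polynomials.
\<close>

type_synonym 'x ncpoly = "'x word \<Rightarrow>\<^sub>0 complex"

definition var :: "'x \<Rightarrow> 'x ncpoly" where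
  "var x = Poly_Mapping.single (Word [x]) 1"

definition scale :: "complex \<Rightarrow> 'x ncpoly \<Rightarrow> 'x ncpoly" where
  "scale c p = Poly_Mapping.map (\<lambda>a. c * a) p"

definition free_algebra :: "(complex, 'x ncpoly) module" where
  "free_algebra =
    \<lparr>carrier = UNIV, mult = (*), one = 1, zero = 0, add = (+), smult = scale\<rparr>"

definition quot_algebra :: "(complex, 'a) module \<Rightarrow> 'a set \<Rightarrow> (complex, 'a set) module" where
  "quot_algebra M I = ring.extend (M Quot I)
    (module.fields (\<lambda>c X. \<Union>x\<in>X. I +>\<^bsub>M\<^esub> (c \<odot>\<^bsub>M\<^esub> x)))"

text \<open>
  A relation \<open>p = q\<close> is encoded by the element \<open>p - q\<close> of the set \<open>S\<close>.  The two-sided ideal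
  generated by \<open>S\<close> as a ring ideal is closed under scalars, because the scalars embed in the
  free algebra.
\<close>

definition relation_ideal :: "'x ncpoly set \<Rightarrow> 'x ncpoly set" where
  "relation_ideal S = Idl\<^bsub>free_algebra\<^esub> S"

definition presented_algebra :: "'x ncpoly set \<Rightarrow> (complex, 'x ncpoly set) module" where
  "presented_algebra S = quot_algebra free_algebra (relation_ideal S)"

definition generator :: "'x ncpoly set \<Rightarrow> 'x \<Rightarrow> 'x ncpoly set" where
  "generator S x = relation_ideal S +>\<^bsub>free_algebra\<^esub> var x"

lemma lookup_scale: "Poly_Mapping.lookup (scale c p) w = c * Poly_Mapping.lookup p w"
  by (simp add: scale_def Poly_Mapping.map.rep_eq when_def)

lemma scale_conv_mult: "scale c p = Poly_Mapping.single 0 c * p"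
  by (rule poly_mapping_eqI)
    (simp add: lookup_scale lookup_mult lookup_single when_mult Sum_any_when_equal')

lemma scale_add: "scale c (p + q) = scale c p + scale c q"
  by (simp add: scale_conv_mult distrib_left)

lemma ring_free_algebra: "ring free_algebra"
proof (rule ringI)
  have "\<exists>y. y + x = 0 \<and> x + y = 0" for x :: "'a ncpoly"
    by (rule exI[of _ "- x"]) simp
  then show "abelian_group (free_algebra :: (complex, 'a ncpoly) module)"
    by (intro abelian_groupI) (auto simp: free_algebra_def ac_simps)
  show "Group.monoid (free_algebra :: (complex, 'a ncpoly) module)"
    by (rule Group.monoidI) (auto simp: free_algebra_def ac_simps)
qed (auto simp: free_algebra_def distrib_left distrib_right)

lemma ideal_relation_ideal: "ideal (relation_ideal S) free_algebra"
  unfolding relation_ideal_def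
  by (rule ring.genideal_ideal[OF ring_free_algebra]) (simp add: free_algebra_def)

lemma relation_ideal_scale: "p \<in> relation_ideal S \<Longrightarrow> scale c p \<in> relation_ideal S"
  using ideal.I_l_closed[OF ideal_relation_ideal, of p S "Poly_Mapping.single 0 c"]
  by (simp add: scale_conv_mult free_algebra_def)

lemma ring_presented_algebra: "ring (presented_algebra S)"
proof -
  let ?Q = "free_algebra Quot relation_ideal S" and ?P = "presented_algebra S"
  interpret Q: ring ?Q
    by (rule ideal.quotient_is_ring[OF ideal_relation_ideal])
  have eqs: "carrier ?P = carrier ?Q" "mult ?P = mult ?Q" "one ?P = one ?Q"
    "zero ?P = zero ?Q" "add ?P = add ?Q"
    by (simp_all add: presented_algebra_def quot_algebra_def ring.defs module.defs)
  show ?thesis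
  proof (rule ringI)
    show "abelian_group ?P"
    proof (rule abelian_groupI, unfold eqs)
      fix x assume "x \<in> carrier ?Q"
      then show "\<exists>y \<in> carrier ?Q. y \<oplus>\<^bsub>?Q\<^esub> x = \<zero>\<^bsub>?Q\<^esub>"
        by (intro bexI[of _ "\<ominus>\<^bsub>?Q\<^esub> x"] Q.l_neg Q.a_inv_closed)
    qed (rule Q.a_closed Q.zero_closed Q.a_assoc Q.a_comm Q.l_zero; assumption)+
    show "Group.monoid ?P"
      by (rule Group.monoidI, unfold eqs)
        (rule Q.m_closed Q.one_closed Q.m_assoc Q.l_one Q.r_one; assumption)+
  qed (unfold eqs, (rule Q.l_distr Q.r_distr; assumption)+)
qed

lemma presented_algebra_smult:
  "c \<odot>\<^bsub>presented_algebra S\<^esub> (relation_ideal S +>\<^bsub>free_algebra\<^esub> p)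
    = relation_ideal S +>\<^bsub>free_algebra\<^esub> scale c p"
proof -
  let ?I = "relation_ideal S" and ?F = "free_algebra :: (complex, 'a ncpoly) module"
  interpret ideal ?I ?F by (rule ideal_relation_ideal)
  have *: "?I +>\<^bsub>?F\<^esub> scale c x = ?I +>\<^bsub>?F\<^esub> scale c p" if x: "x \<in> ?I +>\<^bsub>?F\<^esub> p" for x
  proof -
    from x obtain i where i: "i \<in> ?I" "x = i + p"
      by (auto simp: a_r_coset_def' free_algebra_def)
    have "scale c x \<in> ?I +>\<^bsub>?F\<^esub> scale c p"
      using relation_ideal_scale[OF i(1), of c] i(2)
      by (auto simp: a_r_coset_def' free_algebra_def scale_add)
    then show ?thesis
      by (intro a_repr_independence'[symmetric]) (auto simp: free_algebra_def)
  qed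
  have "p \<in> ?I +>\<^bsub>?F\<^esub> p" by (rule a_rcos_self) (simp add: free_algebra_def)
  have "(\<Union>x \<in> ?I +>\<^bsub>?F\<^esub> p. ?I +>\<^bsub>?F\<^esub> scale c x) = ?I +>\<^bsub>?F\<^esub> scale c p"
    by (rule SUP_eq_const) (use \<open>p \<in> _\<close> * in blast)+
  moreover have "c \<odot>\<^bsub>presented_algebra S\<^esub> X = (\<Union>x\<in>X. ?I +>\<^bsub>?F\<^esub> scale c x)" for X
    by (simp add: presented_algebra_def quot_algebra_def ring.defs module.defs)
      (simp add: free_algebra_def)
  ultimately show ?thesis by simp
qed

definition alg_hom :: "(complex, 'a) module \<Rightarrow> (complex, 'b) module \<Rightarrow> ('a \<Rightarrow> 'b) set" where
  "alg_hom M N = {h \<in> ring_hom M N.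
    \<forall>c. \<forall>x \<in> carrier M. h (c \<odot>\<^bsub>M\<^esub> x) = c \<odot>\<^bsub>N\<^esub> h x}"

definition alg_iso :: "(complex, 'a) module \<Rightarrow> (complex, 'b) module \<Rightarrow> ('a \<Rightarrow> 'b) set" where
  "alg_iso M N = {h \<in> alg_hom M N. bij_betw h (carrier M) (carrier N)}"

definition commutator :: "('a, 'm) ring_scheme \<Rightarrow> 'a \<Rightarrow> 'a \<Rightarrow> 'a" where
  "commutator R x y = x \<otimes>\<^bsub>R\<^esub> y \<ominus>\<^bsub>R\<^esub> y \<otimes>\<^bsub>R\<^esub> x"

datatype sl2_gen = gE | gF | gH

definition sl2_relations :: "sl2_gen ncpoly set" where
  "sl2_relations =
    (let E = var gE; F = var gF; H = var gH in
      {(H * E - E * H) - scale 2 E,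
       (H * F - F * H) - scale (-2) F,
       (E * F - F * E) - H})"

definition Usl2 :: "(complex, sl2_gen ncpoly set) module" where
  "Usl2 = presented_algebra sl2_relations"

definition uE :: "sl2_gen ncpoly set" where "uE = generator sl2_relations gE"
definition uF :: "sl2_gen ncpoly set" where "uF = generator sl2_relations gF"
definition uH :: "sl2_gen ncpoly set" where "uH = generator sl2_relations gH"

datatype kraw_gen = gA | gB

definition kraw_relations :: "complex \<Rightarrow> kraw_gen ncpoly set" where
  "kraw_relations \<omega> =
    (let A = var gA; B = var gB in
      {(A^2 * B - scale 2 (A * B * A) + B * A^2) - (B + scale \<omega> A),
       (B^2 * A - scale 2 (B * A * B) + A * B^2) - (A + scale \<omega> B)})"

definition Kraw :: "complex \<Rightarrow> (complex, kraw_gen ncpoly set) module" where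
  "Kraw \<omega> = presented_algebra (kraw_relations \<omega>)"

definition kA :: "complex \<Rightarrow> kraw_gen ncpoly set" where
  "kA \<omega> = generator (kraw_relations \<omega>) gA"
definition kB :: "complex \<Rightarrow> kraw_gen ncpoly set" where
  "kB \<omega> = generator (kraw_relations \<omega>) gB"
definition kC :: "complex \<Rightarrow> kraw_gen ncpoly set" where
  "kC \<omega> = commutator (Kraw \<omega>) (kA \<omega>) (kB \<omega>)"

text \<open>
  Homomorphisms matter only on the carrier; extensionality (value \<open>undefined\<close> off the carrier)
  makes equality of functions coincide with equality of homomorphisms.
\<close>

definition is_zeta :: "complex \<Rightarrow> (kraw_gen ncpoly set \<Rightarrow> sl2_gen ncpoly set) \<Rightarrow> bool" where
  "is_zeta \<omega> \<zeta> \<longleftrightarrow>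
    \<zeta> \<in> alg_hom (Kraw \<omega>) Usl2 \<and> \<zeta> \<in> extensional (carrier (Kraw \<omega>)) \<and>
    \<zeta> (kA \<omega>) = ((1 + \<omega>) / 2) \<odot>\<^bsub>Usl2\<^esub> uE \<oplus>\<^bsub>Usl2\<^esub> ((1 - \<omega>) / 2) \<odot>\<^bsub>Usl2\<^esub> uF
                 \<ominus>\<^bsub>Usl2\<^esub> (\<omega> / 2) \<odot>\<^bsub>Usl2\<^esub> uH \<and>
    \<zeta> (kB \<omega>) = (1 / 2) \<odot>\<^bsub>Usl2\<^esub> uH \<and>
    \<zeta> (kC \<omega>) = (- ((1 + \<omega>) / 2)) \<odot>\<^bsub>Usl2\<^esub> uE \<oplus>\<^bsub>Usl2\<^esub> ((1 - \<omega>) / 2) \<odot>\<^bsub>Usl2\<^esub> uF"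

end

theory Submission
  imports Defs
begin

text \<open>
  The defining relations of the Krawtchouk algebra say \<open>[A, C] = B + \<omega>A\<close> and \<open>[C, B] = A + \<omega>B\<close>
  with \<open>C = [A, B]\<close>.  So \<open>A\<close>, \<open>B\<close>, \<open>C\<close> span a Lie algebra, and the prescribed
  images of \<open>A\<close>, \<open>B\<close>, \<open>C\<close> satisfy the same commutation relations in \<open>sl\<^sub>2\<close>; this gives the
  homomorphism, which is unique because \<open>A\<close> and \<open>B\<close> generate.  When \<open>\<omega>\<^sup>2 \<noteq> 1\<close> the linear map
  on the spans is invertible, and its inverse respects the relations of \<open>sl\<^sub>2\<close>.
\<close>

subsection \<open>Substitution in noncommutative polynomials\<close>

lemma ncpoly_induct_single [case_names single add]:
  assumes "\<And>w c. P (Poly_Mapping.single w c)" "\<And>p q. P p \<Longrightarrow> P q \<Longrightarrow> P (p + q)"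
  shows "P (p :: 'x ncpoly)"
proof (induction p rule: update_induct)
  case const
  then show ?case using assms(1)[of 0 0] by simp
next
  case (update p w c)
  have "Poly_Mapping.update w c p = p + Poly_Mapping.single w c"
    using update(1) by (intro poly_mapping_eqI) (auto simp: lookup_update lookup_add lookup_single in_keys_iff)
  then show ?case using assms update by simp
qed

lemma scale_one: "scale 1 p = p"
  and scale_scale: "scale c (scale d p) = scale (c * d) p"
  and scale_add_left: "scale (c + d) p = scale c p + scale d p"
  and scale_minus_right: "scale c (p - q) = scale c p - scale c q"
  and scale_uminus_left: "scale (- c) p = - scale c p"
  by (rule poly_mapping_eqI, simp add: lookup_scale lookup_add lookup_minus algebra_simps)+

lemma scale_mult_left: "scale c p * q = scale c (p * q)"
  by (simp add: scale_conv_mult mult.assoc)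

text \<open>Scalars are central: a constant polynomial is supported on the empty word, so it
  commutes with every monomial, and additivity does the rest.\<close>

lemma scale_mult_right: "p * scale c q = scale c (p * q)"
proof (induction p rule: ncpoly_induct_single)
  case (single w d)
  have "Poly_Mapping.single w d * Poly_Mapping.single 0 c
      = Poly_Mapping.single 0 c * Poly_Mapping.single w d"
    by (simp add: mult_single mult.commute)
  then show ?case by (simp add: scale_conv_mult flip: mult.assoc)
qed (simp add: distrib_right scale_add)

lemma single_conv_scale: "Poly_Mapping.single w c = scale c (Poly_Mapping.single w 1)"
  by (simp add: scale_conv_mult mult_single)

primrec letters :: "'x word \<Rightarrow> 'x list" where
  "letters (Word u) = u"

lemma letters_zero: "letters 0 = []"
  by (simp add: zero_word_def)

lemma letters_add: "letters (u + v) = letters u @ letters v"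
  by (cases u; cases v) simp

text \<open>This is the algebra homomorphism given by the universal property of the free algebra.
  The sum ranges over all words, but only the support of \<open>p\<close> contributes.\<close>

definition subst :: "('x \<Rightarrow> 'y ncpoly) \<Rightarrow> 'x ncpoly \<Rightarrow> 'y ncpoly" where
  "subst f p = (\<Sum>w. scale (Poly_Mapping.lookup p w) (prod_list (map f (letters w))))"

lemma subst_single:
  fixes f :: "'x \<Rightarrow> 'y ncpoly"
  shows "subst f (Poly_Mapping.single w c) = scale c (prod_list (map f (letters w)))"
proof -
  have "scale (Poly_Mapping.lookup (Poly_Mapping.single w c) v) q = (scale c q when v = w)"
    for v and q :: "'y ncpoly"
    by (auto simp: lookup_single when_def scale_conv_mult)
  then show ?thesis by (simp add: subst_def)
qed

lemma subst_add: "subst f (p + q) = subst f p + subst f q"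
proof -
  \<comment> \<open>\<open>Sum_any\<close> is additive only on finitely supported families; here the
    support lies in the keys of \<open>p\<close>.\<close>
  have "finite {w. scale (Poly_Mapping.lookup p w) (prod_list (map f (letters w))) \<noteq> 0}" for p
    by (rule finite_subset[OF _ finite_keys[of p]])
      (auto simp: in_keys_iff scale_conv_mult)
  then show ?thesis
    by (simp add: subst_def lookup_add scale_add_left Sum_any.distrib)
qed

lemma subst_mult: "subst f (p * q) = subst f p * subst f q"
proof (induction p rule: ncpoly_induct_single)
  case (single u c)
  show ?case
  proof (induction q rule: ncpoly_induct_single)
    case (single v d)
    show ?case
      by (simp add: mult_single subst_single letters_add scale_mult_left scale_mult_right
          scale_scale mult.commute[of c d])
  qed (simp add: distrib_left subst_add)
qed (simp add: distrib_right subst_add)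

lemma subst_one: "subst f 1 = 1"
  by (simp add: subst_single letters_zero scale_one flip: single_one)

lemma subst_scale: "subst f (scale c p) = scale c (subst f p)"
  by (simp add: scale_conv_mult[of c p] subst_mult subst_single letters_zero scale_mult_left)

lemma subst_diff: "subst f (p - q) = subst f p - subst f q"
  using subst_add[of f "p - q" q] by (simp add: algebra_simps)

lemma subst_power: "subst f (p ^ n) = subst f p ^ n"
  by (induction n) (simp_all add: subst_one subst_mult)

lemma subst_var: "subst f (var x) = f x"
  by (simp add: var_def subst_single scale_one)

lemmas subst_simps = subst_add subst_mult subst_one subst_scale subst_diff subst_power subst_var

lemma ncpoly_induct [case_names one var scale add]:
  assumes "P 1" "\<And>x p. P p \<Longrightarrow> P (var x * p)" "\<And>c p. P p \<Longrightarrow> P (scale c p)"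
    "\<And>p q. P p \<Longrightarrow> P q \<Longrightarrow> P (p + q)"
  shows "P (p :: 'x ncpoly)"
proof (induction p rule: ncpoly_induct_single)
  case (single w c)
  have "P (Poly_Mapping.single (Word u) 1)" for u
  proof (induction u)
    case Nil
    then show ?case using assms(1) by (simp flip: single_one zero_word_def)
  next
    case (Cons x u)
    then show ?case using assms(2)[OF Cons, of x] by (simp add: var_def mult_single)
  qed
  then show ?case using assms(3) by (metis single_conv_scale word.exhaust)
qed (rule assms(4))

subsection \<open>Homomorphisms between presented algebras\<close>

text \<open>
  Every element of a presented algebra is the class of a polynomial, so all computations can be done
  with representatives, where equality is membership of the difference in the ideal.
\<close>

definition cls :: "'x ncpoly set \<Rightarrow> 'x ncpoly \<Rightarrow> 'x ncpoly set" where
  "cls S p = relation_ideal S +>\<^bsub>free_algebra\<^esub> p"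

lemma relation_ideal_self: "S \<subseteq> relation_ideal S"
  unfolding relation_ideal_def
  by (rule ring.genideal_self[OF ring_free_algebra]) (simp add: free_algebra_def)

lemma relation_ideal_zero: "0 \<in> relation_ideal S"
  and relation_ideal_add: "p \<in> relation_ideal S \<Longrightarrow> q \<in> relation_ideal S \<Longrightarrow> p + q \<in> relation_ideal S"
  and relation_ideal_mult_left: "p \<in> relation_ideal S \<Longrightarrow> r * p \<in> relation_ideal S"
  and relation_ideal_mult_right: "p \<in> relation_ideal S \<Longrightarrow> p * r \<in> relation_ideal S"
proof -
  interpret ideal "relation_ideal S" free_algebra by (rule ideal_relation_ideal)
  show "0 \<in> relation_ideal S"
    "p \<in> relation_ideal S \<Longrightarrow> q \<in> relation_ideal S \<Longrightarrow> p + q \<in> relation_ideal S"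
    "p \<in> relation_ideal S \<Longrightarrow> r * p \<in> relation_ideal S"
    "p \<in> relation_ideal S \<Longrightarrow> p * r \<in> relation_ideal S"
    using additive_subgroup.zero_closed[OF is_additive_subgroup]
      additive_subgroup.a_closed[OF is_additive_subgroup] I_l_closed I_r_closed by (auto simp: free_algebra_def)
qed

lemma relation_ideal_diff:
  "p \<in> relation_ideal S \<Longrightarrow> q \<in> relation_ideal S \<Longrightarrow> p - q \<in> relation_ideal S"
  using relation_ideal_add[of p S "scale (-1) q"] relation_ideal_scale[of q S "-1"]
  by (simp add: scale_uminus_left scale_one)

lemmas relation_ideal_closed = relation_ideal_zero relation_ideal_add relation_ideal_diff
  relation_ideal_scale relation_ideal_mult_left relation_ideal_mult_right

lemma mem_cls_iff: "p \<in> cls S q \<longleftrightarrow> p - q \<in> relation_ideal S"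
proof -
  have "p \<in> cls S q \<longleftrightarrow> (\<exists>i\<in>relation_ideal S. p = i + q)"
    by (auto simp: cls_def a_r_coset_def' free_algebra_def)
  also have "\<dots> \<longleftrightarrow> p - q \<in> relation_ideal S"
    by (metis add_diff_cancel_right' diff_add_cancel)
  finally show ?thesis .
qed

lemma cls_eq_iff: "cls S p = cls S q \<longleftrightarrow> p - q \<in> relation_ideal S"
proof -
  interpret ideal "relation_ideal S" free_algebra by (rule ideal_relation_ideal)
  have "cls S p = cls S q \<longleftrightarrow> p \<in> cls S q"
    unfolding cls_def
    by (metis a_repr_independence' a_rcos_self UNIV_I free_algebra_def partial_object.select_convs(1))
  then show ?thesis by (simp add: mem_cls_iff)
qed

lemma generator_conv_cls: "generator S x = cls S (var x)"
  by (simp add: generator_def cls_def)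

lemma presented_sel:
  "carrier (presented_algebra S) = range (cls S)"
  "mult (presented_algebra S) (cls S p) (cls S q) = cls S (p * q)"
  "add (presented_algebra S) (cls S p) (cls S q) = cls S (p + q)"
  "one (presented_algebra S) = cls S 1"
  "zero (presented_algebra S) = cls S 0"
  "smult (presented_algebra S) c (cls S p) = cls S (scale c p)"
proof -
  interpret ideal "relation_ideal S" free_algebra by (rule ideal_relation_ideal)
  show "carrier (presented_algebra S) = range (cls S)"
    by (auto simp: presented_algebra_def quot_algebra_def ring.defs module.defs FactRing_simps cls_def)
      (auto simp: free_algebra_def)
  show "mult (presented_algebra S) (cls S p) (cls S q) = cls S (p * q)"
    using rcoset_mult_add[of p q]
    by (simp add: presented_algebra_def quot_algebra_def ring.defs module.defs FactRing_def cls_def)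
       (simp add: free_algebra_def)
  show "add (presented_algebra S) (cls S p) (cls S q) = cls S (p + q)"
    using a_rcos_sum[of p q]
    by (simp add: presented_algebra_def quot_algebra_def ring.defs module.defs FactRing_def cls_def)
       (simp add: free_algebra_def)
  show "one (presented_algebra S) = cls S 1"
    by (simp add: presented_algebra_def quot_algebra_def ring.defs module.defs FactRing_def cls_def)
       (simp add: free_algebra_def)
  \<comment> \<open>The zero of the quotient is the ideal itself, so it is compared with the class
    of 0 element by element.\<close>
  show "zero (presented_algebra S) = cls S 0"
    by (simp add: presented_algebra_def quot_algebra_def ring.defs module.defs FactRing_def)
       (auto simp: set_eq_iff mem_cls_iff)
  show "smult (presented_algebra S) c (cls S p) = cls S (scale c p)"
    by (simp add: cls_def presented_algebra_smult)
qed

lemma presented_minus: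
  "cls S p \<ominus>\<^bsub>presented_algebra S\<^esub> cls S q = cls S (p - q)"
proof -
  interpret ring "presented_algebra S" by (rule ring_presented_algebra)
  have "\<ominus>\<^bsub>presented_algebra S\<^esub> cls S q = cls S (- q)"
    by (rule minus_equality) (simp_all add: presented_sel)
  then show ?thesis by (simp add: a_minus_def presented_sel)
qed

lemmas presented_simps = presented_sel presented_minus

text \<open>The preimage of an ideal under a homomorphism is an ideal. Once it contains
  \<open>S\<close>, it contains the ideal generated by \<open>S\<close>.\<close>

lemma subst_relation_ideal:
  assumes "\<And>r. r \<in> S \<Longrightarrow> subst f r \<in> relation_ideal T" "p \<in> relation_ideal S"
  shows "subst f p \<in> relation_ideal T"
proof -
  let ?J = "{p. subst f p \<in> relation_ideal T}"
  have neg: "\<ominus>\<^bsub>free_algebra\<^esub> p = - p" for p :: "'a ncpoly"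
    by (rule abelian_group.minus_equality[OF ring.is_abelian_group[OF ring_free_algebra]])
      (simp_all add: free_algebra_def)
  have "ideal ?J free_algebra"
  proof (rule idealI)
    have "subst f (- p) = scale (-1) (subst f p)" for p
      by (metis scale_one scale_uminus_left subst_scale)
    moreover have "subst f 0 = 0"
      using subst_diff[of f 0 0] by simp
    then have "0 \<in> ?J" by (simp add: relation_ideal_zero)
    ultimately show "subgroup ?J (add_monoid free_algebra)"
      using neg unfolding a_inv_def
      by (intro group.subgroupI abelian_group.a_group ring.is_abelian_group ring_free_algebra)
        (auto simp: free_algebra_def subst_simps intro: relation_ideal_closed)
  qed (auto simp: free_algebra_def subst_simps ring_free_algebra[unfolded free_algebra_def] relation_ideal_closed)
  then have "relation_ideal S \<subseteq> ?J"
    unfolding relation_ideal_def[of S] using assms(1)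
    by (intro ring.genideal_minimal[OF ring_free_algebra]) auto
  then show ?thesis using assms(2) by auto
qed

text \<open>Universal property of a presentation: a substitution that sends relators into the target
  ideal descends to the quotients.\<close>

lemma presented_hom_exists:
  assumes "\<And>r. r \<in> S \<Longrightarrow> subst f r \<in> relation_ideal T"
  obtains h where "h \<in> alg_hom (presented_algebra S) (presented_algebra T)"
    "h \<in> extensional (carrier (presented_algebra S))"
    "\<And>p. h (cls S p) = cls T (subst f p)"
proof -
  \<comment> \<open>Some representative of each class is chosen; \<open>subst_relation_ideal\<close>
    shows that the choice does not affect the value.\<close>
  define h where "h = restrict (\<lambda>X. cls T (subst f (SOME p. X = cls S p)))
    (carrier (presented_algebra S))"
  have h: "h (cls S p) = cls T (subst f p)" for p
  proof -
    have "cls S p = cls S (SOME q. cls S p = cls S q)"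
      by (rule someI[of _ p]) simp
    then have "cls T (subst f p) = cls T (subst f (SOME q. cls S p = cls S q))"
      unfolding cls_eq_iff subst_diff[symmetric] by (intro subst_relation_ideal[OF assms])
    then show ?thesis by (simp add: h_def presented_simps)
  qed
  show ?thesis
  proof (rule that[OF _ _ h])
    show "h \<in> alg_hom (presented_algebra S) (presented_algebra T)"
      by (auto simp: alg_hom_def ring_hom_def presented_simps h subst_simps)
    show "h \<in> extensional (carrier (presented_algebra S))"
      unfolding h_def by (rule restrict_extensional)
  qed
qed

text \<open>The generators determine a homomorphism, by induction along
  \<open>ncpoly_induct\<close>. Uniqueness of \<open>\<zeta>\<close> rests on this.\<close>

lemma alg_hom_eq_subst:
  assumes h: "h \<in> alg_hom (presented_algebra S) (presented_algebra T)"
    and gen: "\<And>x. h (generator S x) = cls T (f x)"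
  shows "h (cls S p) = cls T (subst f p)"
proof -
  have h_simps: "h (cls S 1) = cls T 1"
    "h (cls S (p * q)) = h (cls S p) \<otimes>\<^bsub>presented_algebra T\<^esub> h (cls S q)"
    "h (cls S (p + q)) = h (cls S p) \<oplus>\<^bsub>presented_algebra T\<^esub> h (cls S q)"
    "h (cls S (scale c p)) = c \<odot>\<^bsub>presented_algebra T\<^esub> h (cls S p)" for p q c
    using h by (auto simp: alg_hom_def ring_hom_def presented_sel simp flip: presented_sel(2,3,6))
  show ?thesis
    by (induction p rule: ncpoly_induct)
      (simp_all add: h_simps presented_simps subst_simps gen flip: generator_conv_cls)
qed

lemma subst_subst: "subst f (subst g p) = subst (\<lambda>x. subst f (g x)) p"
  by (induction p rule: ncpoly_induct) (simp_all add: subst_simps)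

text \<open>A substitution that fixes the generators modulo the ideal induces the identity on the
  quotient. Both composites of \<open>\<zeta>\<close> with its inverse are treated this way.\<close>

lemma cls_subst_eq_self:
  assumes "\<And>x. cls S (f x) = generator S x"
  shows "cls S (subst f p) = cls S p"
proof (induction p rule: ncpoly_induct)
  case (var x p)
  then show ?case using assms[of x]
    by (simp add: subst_simps generator_conv_cls flip: presented_sel(2))
next
  case (scale c p)
  then show ?case by (simp add: subst_simps flip: presented_sel(6))
next
  case (add p q)
  then show ?case by (simp add: subst_simps flip: presented_sel(3))
qed (simp add: subst_simps)

subsection \<open>The Krawtchouk algebra and \<open>U(sl\<^sub>2)\<close>\<close>

definition zeta_gen :: "complex \<Rightarrow> kraw_gen \<Rightarrow> sl2_gen ncpoly" where
  "zeta_gen \<omega> x = (case x of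
      gA \<Rightarrow> scale ((1 + \<omega>) / 2) (var gE) + scale ((1 - \<omega>) / 2) (var gF) - scale (\<omega> / 2) (var gH)
    | gB \<Rightarrow> scale (1 / 2) (var gH))"

text \<open>\<open>C\<close> is written out as a commutator because only \<open>A\<close> and
  \<open>B\<close> are generators. The values are meaningful for
  \<open>\<omega>\<^sup>2 \<noteq> 1\<close>; otherwise a division by zero yields 0.\<close>

definition zeta_inv_gen :: "complex \<Rightarrow> sl2_gen \<Rightarrow> kraw_gen ncpoly" where
  "zeta_inv_gen \<omega> x = (let C = var gA * var gB - var gB * var gA in case x of
      gE \<Rightarrow> scale (1 / (1 + \<omega>)) (var gA) + scale (\<omega> / (1 + \<omega>)) (var gB) - scale (1 / (1 + \<omega>)) C
    | gF \<Rightarrow> scale (1 / (1 - \<omega>)) (var gA) + scale (\<omega> / (1 - \<omega>)) (var gB) + scale (1 / (1 - \<omega>)) C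
    | gH \<Rightarrow> scale 2 (var gB))"

text \<open>
  Identities between noncommutative polynomials are checked by expanding both sides into linear
  combinations of monomials and comparing coefficients; this turns them into identities of complex
  numbers, where the values of the monomials are opaque atoms.
\<close>

lemmas ncpoly_expand = distrib_left distrib_right left_diff_distrib right_diff_distrib
  scale_mult_left scale_mult_right scale_add scale_minus_right scale_scale mult.assoc power2_eq_square

lemmas ncpoly_lookup = lookup_add lookup_minus lookup_scale

section \<open>Images of the defining relators under the two substitutions\<close>

definition relHE :: "sl2_gen ncpoly" where
  "relHE = (var gH * var gE - var gE * var gH) - scale 2 (var gE)"
definition relHF :: "sl2_gen ncpoly" where
  "relHF = (var gH * var gF - var gF * var gH) - scale (-2) (var gF)"
definition relEF :: "sl2_gen ncpoly" where
  "relEF = (var gE * var gF - var gF * var gE) - var gH"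

lemma sl2_rels: "sl2_relations = {relHE, relHF, relEF}"
  by (simp add: sl2_relations_def Let_def relHE_def relHF_def relEF_def)

definition relA :: "complex \<Rightarrow> kraw_gen ncpoly" where
  "relA \<omega> = ((var gA)^2 * var gB - scale 2 (var gA * var gB * var gA) + var gB * (var gA)^2)
    - (var gB + scale \<omega> (var gA))"
definition relB :: "complex \<Rightarrow> kraw_gen ncpoly" where
  "relB \<omega> = ((var gB)^2 * var gA - scale 2 (var gB * var gA * var gB) + var gA * (var gB)^2)
    - (var gA + scale \<omega> (var gB))"

lemma kraw_rels: "kraw_relations \<omega> = {relA \<omega>, relB \<omega>}"
  by (simp add: kraw_relations_def Let_def relA_def relB_def)

text \<open>The \<open>H\<close> term in the image of \<open>A\<close> commutes with the image of
  \<open>B\<close>. Replacing \<open>[H, E]\<close> by \<open>relHE + 2E\<close> and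
  \<open>[H, F]\<close> by \<open>relHF - 2F\<close> leaves these multiples of relators, which
  certify membership in the ideal.\<close>

lemma zeta_gen_commutator:
  "(zeta_gen \<omega> gA * zeta_gen \<omega> gB - zeta_gen \<omega> gB * zeta_gen \<omega> gA)
   - (scale (- ((1 + \<omega>) / 2)) (var gE) + scale ((1 - \<omega>) / 2) (var gF))
   = scale (- ((1 + \<omega>) / 4)) relHE + scale (- ((1 - \<omega>) / 4)) relHF"
  unfolding zeta_gen_def relHE_def relHF_def kraw_gen.case ncpoly_expand
  by (rule poly_mapping_eqI) (simp add: ncpoly_lookup, simp add: field_simps)

text \<open>
  The left-hand side of the first relation is \<open>[A, [A, B]]\<close>, and \<open>N\<close> is the error made by replacing
  the image of \<open>[A, B]\<close> by the prescribed image of \<open>C\<close>.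
\<close>

lemma subst_zeta_gen_relA:
  fixes \<omega> :: complex
  defines "N \<equiv> scale (- ((1 + \<omega>) / 4)) relHE + scale (- ((1 - \<omega>) / 4)) relHF"
  shows "subst (zeta_gen \<omega>) (relA \<omega>) = zeta_gen \<omega> gA * N - N * zeta_gen \<omega> gA
    + scale ((1 - \<omega>\<^sup>2) / 2) relEF + scale (\<omega> * (1 + \<omega>) / 4) relHE + scale (- (\<omega> * (1 - \<omega>) / 4)) relHF"
  unfolding N_def relA_def subst_simps zeta_gen_def relHE_def relHF_def relEF_def kraw_gen.case ncpoly_expand
  by (rule poly_mapping_eqI) (simp add: ncpoly_lookup, simp add: field_simps)

text \<open>The relator is \<open>[B, [B, A]] - A - \<omega>B\<close> with \<open>B\<close> sent to
  \<open>H/2\<close>. Modulo the relators, \<open>E\<close> and \<open>F\<close> have eigenvalue 4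
  under the square of \<open>ad H\<close>, which the factor 1/4 turns into 1; the \<open>H\<close>
  terms of \<open>A\<close> and \<open>\<omega>B\<close> cancel.\<close>

lemma subst_zeta_gen_relB:
  "subst (zeta_gen \<omega>) (relB \<omega>)
    = scale ((1 + \<omega>) / 8) (var gH * relHE - relHE * var gH + scale 2 relHE)
    + scale ((1 - \<omega>) / 8) (var gH * relHF - relHF * var gH - scale 2 relHF)"
  unfolding relB_def subst_simps zeta_gen_def relHE_def relHF_def kraw_gen.case ncpoly_expand
  by (rule poly_mapping_eqI) (simp add: ncpoly_lookup, simp add: field_simps)

text \<open>The last two inequations are conditions that \<open>divide_simps\<close> generates in this form.\<close>

lemma sq_neq_one_nonzero:
  fixes \<omega> :: complex
  assumes "\<omega>\<^sup>2 \<noteq> 1"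
  shows "1 + \<omega> \<noteq> 0" "1 - \<omega> \<noteq> 0" "\<omega> * \<omega> \<noteq> 1" "2 + \<omega> * 2 \<noteq> 0" "4 + \<omega> * 4 \<noteq> 0"
proof -
  show "1 + \<omega> \<noteq> 0" "1 - \<omega> \<noteq> 0" "\<omega> * \<omega> \<noteq> 1"
    using assms by (auto simp: power2_eq_square add_eq_0_iff)
  moreover have "2 + \<omega> * 2 = 2 * (1 + \<omega>)" "4 + \<omega> * 4 = 4 * (1 + \<omega>)"
    by simp_all
  ultimately show "2 + \<omega> * 2 \<noteq> 0" "4 + \<omega> * 4 \<noteq> 0"
    by (metis mult_eq_0_iff zero_neq_numeral)+
qed

text \<open>Put \<open>X = A + \<omega>B\<close>, so that \<open>E\<close> and \<open>F\<close> go
  to \<open>(X - C)/(1 + \<omega>)\<close> and \<open>(X + C)/(1 - \<omega>)\<close>. Then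
  \<open>[B, X] = -C\<close> exactly and \<open>[B, C] = -X\<close> up to \<open>relB\<close>, so
  these are eigenvectors of \<open>ad 2B\<close> for 2 and -2. Their commutator is
  \<open>2[X, C]/(1 - \<omega>\<^sup>2)\<close>, where
  \<open>[X, C] = (1 - \<omega>\<^sup>2)B\<close> up to \<open>relA - \<omega> relB\<close>.\<close>

lemma
  assumes "\<omega>\<^sup>2 \<noteq> 1"
  shows subst_zeta_inv_gen_relHE: "subst (zeta_inv_gen \<omega>) relHE = scale (2 / (1 + \<omega>)) (relB \<omega>)"
    and subst_zeta_inv_gen_relHF: "subst (zeta_inv_gen \<omega>) relHF = scale (- (2 / (1 - \<omega>))) (relB \<omega>)"
    and subst_zeta_inv_gen_relEF: "subst (zeta_inv_gen \<omega>) relEF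
      = scale (2 / (1 - \<omega>\<^sup>2)) (relA \<omega>) - scale (2 * \<omega> / (1 - \<omega>\<^sup>2)) (relB \<omega>)"
proof -
  note nz = sq_neq_one_nonzero[OF assms]
  \<comment> \<open>The factored form matches the denominators produced by multiplying the images of
    \<open>E\<close> and \<open>F\<close>.\<close>
  have split: "1 - \<omega>\<^sup>2 = (1 + \<omega>) * (1 - \<omega>)"
    by (simp add: algebra_simps power2_eq_square)
  show "subst (zeta_inv_gen \<omega>) relHE = scale (2 / (1 + \<omega>)) (relB \<omega>)"
    unfolding relHE_def relB_def subst_simps zeta_inv_gen_def Let_def sl2_gen.case ncpoly_expand
    using nz by (intro poly_mapping_eqI) (simp only: ncpoly_lookup, simp add: divide_simps, (simp add: algebra_simps)?)
  show "subst (zeta_inv_gen \<omega>) relHF = scale (- (2 / (1 - \<omega>))) (relB \<omega>)"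
    unfolding relHF_def relB_def subst_simps zeta_inv_gen_def Let_def sl2_gen.case ncpoly_expand
    using nz by (intro poly_mapping_eqI) (simp only: ncpoly_lookup, simp add: divide_simps, (simp add: algebra_simps)?)
  show "subst (zeta_inv_gen \<omega>) relEF
      = scale (2 / (1 - \<omega>\<^sup>2)) (relA \<omega>) - scale (2 * \<omega> / (1 - \<omega>\<^sup>2)) (relB \<omega>)"
    unfolding relEF_def relA_def relB_def subst_simps zeta_inv_gen_def Let_def sl2_gen.case ncpoly_expand split
    using nz by (intro poly_mapping_eqI) (simp only: ncpoly_lookup, simp add: divide_simps, (simp add: algebra_simps)?)
qed

lemma subst_zeta_gen_relations:
  assumes "r \<in> kraw_relations \<omega>"
  shows "subst (zeta_gen \<omega>) r \<in> relation_ideal sl2_relations"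
proof -
  have "relHE \<in> relation_ideal sl2_relations" "relHF \<in> relation_ideal sl2_relations"
    "relEF \<in> relation_ideal sl2_relations"
    using relation_ideal_self[of sl2_relations] by (auto simp: sl2_rels)
  then show ?thesis
    using assms by (auto simp: kraw_rels subst_zeta_gen_relA subst_zeta_gen_relB relation_ideal_closed)
qed

lemma subst_zeta_inv_gen_relations:
  assumes "\<omega>\<^sup>2 \<noteq> 1" "r \<in> sl2_relations"
  shows "subst (zeta_inv_gen \<omega>) r \<in> relation_ideal (kraw_relations \<omega>)"
proof -
  have "relA \<omega> \<in> relation_ideal (kraw_relations \<omega>)" "relB \<omega> \<in> relation_ideal (kraw_relations \<omega>)"
    using relation_ideal_self[of "kraw_relations \<omega>"] by (auto simp: kraw_rels)
  then show ?thesis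
    using assms
    by (auto simp: sl2_rels subst_zeta_inv_gen_relHE subst_zeta_inv_gen_relHF subst_zeta_inv_gen_relEF relation_ideal_closed)
qed

section \<open>Evaluation of \<open>\<zeta>\<close> on classes\<close>

lemma generators_cls:
  "kA \<omega> = cls (kraw_relations \<omega>) (var gA)" "kB \<omega> = cls (kraw_relations \<omega>) (var gB)"
  "kC \<omega> = cls (kraw_relations \<omega>) (var gA * var gB - var gB * var gA)"
  "uE = cls sl2_relations (var gE)" "uF = cls sl2_relations (var gF)" "uH = cls sl2_relations (var gH)"
  by (simp_all add: kA_def kB_def kC_def uE_def uF_def uH_def generator_conv_cls commutator_def
      Kraw_def presented_simps)

lemma cls_zeta_commutator:
  "cls sl2_relations (subst (zeta_gen \<omega>) (var gA * var gB - var gB * var gA)) =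
    cls sl2_relations (scale (- ((1 + \<omega>) / 2)) (var gE) + scale ((1 - \<omega>) / 2) (var gF))"
proof -
  have "relHE \<in> relation_ideal sl2_relations" "relHF \<in> relation_ideal sl2_relations"
    using relation_ideal_self[of sl2_relations] by (auto simp: sl2_rels)
  then show ?thesis
    unfolding cls_eq_iff subst_simps zeta_gen_commutator by (intro relation_ideal_closed)
qed

text \<open>The values at \<open>A\<close> and \<open>B\<close> fix \<open>\<zeta>\<close> on every
  class, since these generate. Conversely, evaluation at the commutator gives the prescribed value
  at \<open>C\<close> by \<open>cls_zeta_commutator\<close>.\<close>

lemma is_zeta_iff:
  "is_zeta \<omega> \<zeta> \<longleftrightarrow> \<zeta> \<in> alg_hom (Kraw \<omega>) Usl2 \<and> \<zeta> \<in> extensional (carrier (Kraw \<omega>)) \<and>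
    (\<forall>p. \<zeta> (cls (kraw_relations \<omega>) p) = cls sl2_relations (subst (zeta_gen \<omega>) p))"
    (is "_ \<longleftrightarrow> ?hom \<and> ?ext \<and> ?eval")
proof
  assume z: "is_zeta \<omega> \<zeta>"
  then have hom: ?hom and ext: ?ext by (auto simp: is_zeta_def)
  have "\<zeta> (generator (kraw_relations \<omega>) x) = cls sl2_relations (zeta_gen \<omega> x)" for x
    using z by (cases x) (simp_all add: is_zeta_def generators_cls generator_conv_cls zeta_gen_def
        Usl2_def presented_simps)
  then have ?eval
    using alg_hom_eq_subst[OF hom[unfolded Kraw_def Usl2_def]] by blast
  with hom ext show "?hom \<and> ?ext \<and> ?eval" by blast
next
  assume "?hom \<and> ?ext \<and> ?eval"
  then show "is_zeta \<omega> \<zeta>"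
    by (simp add: is_zeta_def generators_cls cls_zeta_commutator)
      (simp add: subst_var zeta_gen_def Usl2_def presented_simps)
qed

section \<open>The two substitutions as mutual inverses\<close>

lemma zeta_gen_zeta_inv_gen:
  assumes "\<omega>\<^sup>2 \<noteq> 1"
  shows "cls sl2_relations (subst (zeta_gen \<omega>) (zeta_inv_gen \<omega> x)) = generator sl2_relations x"
proof -
  note nz = sq_neq_one_nonzero[OF assms]
  \<comment> \<open>Keeping the error of the commutator as an opaque \<open>N\<close> leaves only
    linear identities to check.\<close>
  define N where "N = (zeta_gen \<omega> gA * zeta_gen \<omega> gB - zeta_gen \<omega> gB * zeta_gen \<omega> gA)
   - (scale (- ((1 + \<omega>) / 2)) (var gE) + scale ((1 - \<omega>) / 2) (var gF))"
  have N: "zeta_gen \<omega> gA * zeta_gen \<omega> gB - zeta_gen \<omega> gB * zeta_gen \<omega> gA =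
     N + (scale (- ((1 + \<omega>) / 2)) (var gE) + scale ((1 - \<omega>) / 2) (var gF))"
    by (simp add: N_def)
  have "N \<in> relation_ideal sl2_relations"
    using cls_zeta_commutator[of \<omega>] by (simp add: cls_eq_iff N_def subst_simps)
  \<comment> \<open>The multiple of \<open>N\<close> is the coefficient of \<open>C\<close> in
    \<open>zeta_inv_gen\<close>.\<close>
  moreover have "subst (zeta_gen \<omega>) (zeta_inv_gen \<omega> x) - var x
    = scale (case x of gE \<Rightarrow> - (1 / (1 + \<omega>)) | gF \<Rightarrow> 1 / (1 - \<omega>) | gH \<Rightarrow> 0) N"
    using nz by (cases x; simp only: zeta_inv_gen_def Let_def sl2_gen.case subst_simps N;
      unfold zeta_gen_def kraw_gen.case ncpoly_expand; intro poly_mapping_eqI;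
      simp only: ncpoly_lookup; simp add: divide_simps; (simp add: algebra_simps)?)
  ultimately show ?thesis
    by (simp add: generator_conv_cls cls_eq_iff relation_ideal_scale)
qed

text \<open>This composite is exact already for polynomials: the two occurrences of
  \<open>C\<close>, coming from \<open>E\<close> and \<open>F\<close>, cancel.\<close>

lemma zeta_inv_gen_zeta_gen:
  assumes "\<omega>\<^sup>2 \<noteq> 1"
  shows "subst (zeta_inv_gen \<omega>) (zeta_gen \<omega> x) = var x"
proof -
  note nz = sq_neq_one_nonzero[OF assms]
  then show ?thesis
    by (cases x; simp only: zeta_gen_def kraw_gen.case subst_simps;
      unfold zeta_inv_gen_def Let_def sl2_gen.case ncpoly_expand; intro poly_mapping_eqI;
      simp only: ncpoly_lookup; simp add: divide_simps; (simp add: algebra_simps)?)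
qed

theorem theorem1p8:
  fixes \<omega> :: complex
  shows "(\<exists>!\<zeta>. is_zeta \<omega> \<zeta>) \<and>
    (\<forall>\<zeta>. is_zeta \<omega> \<zeta> \<longrightarrow> \<omega>\<^sup>2 \<noteq> 1 \<longrightarrow>
      \<zeta> \<in> alg_iso (Kraw \<omega>) Usl2 \<and>
      inv_into (carrier (Kraw \<omega>)) \<zeta> uE =
        (1 / (1 + \<omega>)) \<odot>\<^bsub>Kraw \<omega>\<^esub> kA \<omega> \<oplus>\<^bsub>Kraw \<omega>\<^esub> (\<omega> / (1 + \<omega>)) \<odot>\<^bsub>Kraw \<omega>\<^esub> kB \<omega>
          \<ominus>\<^bsub>Kraw \<omega>\<^esub> (1 / (1 + \<omega>)) \<odot>\<^bsub>Kraw \<omega>\<^esub> kC \<omega> \<and>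
      inv_into (carrier (Kraw \<omega>)) \<zeta> uF =
        (1 / (1 - \<omega>)) \<odot>\<^bsub>Kraw \<omega>\<^esub> kA \<omega> \<oplus>\<^bsub>Kraw \<omega>\<^esub> (\<omega> / (1 - \<omega>)) \<odot>\<^bsub>Kraw \<omega>\<^esub> kB \<omega>
          \<oplus>\<^bsub>Kraw \<omega>\<^esub> (1 / (1 - \<omega>)) \<odot>\<^bsub>Kraw \<omega>\<^esub> kC \<omega> \<and>
      inv_into (carrier (Kraw \<omega>)) \<zeta> uH = 2 \<odot>\<^bsub>Kraw \<omega>\<^esub> kB \<omega>)"
proof (intro conjI allI impI)
  let ?R = "kraw_relations \<omega>"
  show "\<exists>!\<zeta>. is_zeta \<omega> \<zeta>"
  proof (rule ex_ex1I)
    show "\<exists>\<zeta>. is_zeta \<omega> \<zeta>"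
      using presented_hom_exists[of ?R "zeta_gen \<omega>" sl2_relations] subst_zeta_gen_relations
      unfolding is_zeta_iff Kraw_def Usl2_def by metis
  next
    fix \<zeta> \<zeta>' assume "is_zeta \<omega> \<zeta>" "is_zeta \<omega> \<zeta>'"
    then show "\<zeta> = \<zeta>'"
      unfolding is_zeta_iff
      \<comment> \<open>On the carrier both maps are given by \<open>zeta_gen\<close>; off it,
        extensionality makes them agree.\<close>
      by (intro extensionalityI[of _ "carrier (Kraw \<omega>)"]) (auto simp: Kraw_def presented_sel)
  qed
  fix \<zeta> assume "is_zeta \<omega> \<zeta>" and \<omega>: "\<omega>\<^sup>2 \<noteq> 1"
  then have hom: "\<zeta> \<in> alg_hom (Kraw \<omega>) Usl2"
    and eval: "\<zeta> (cls ?R p) = cls sl2_relations (subst (zeta_gen \<omega>) p)" for p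
    by (auto simp: is_zeta_iff)
  have inj: "inj_on \<zeta> (carrier (Kraw \<omega>))"
  proof -
    have "cls ?R p = cls ?R q" if "\<zeta> (cls ?R p) = \<zeta> (cls ?R q)" for p q
    proof -
      have "subst (zeta_gen \<omega>) (p - q) \<in> relation_ideal sl2_relations"
        using that by (simp add: eval cls_eq_iff subst_diff)
      \<comment> \<open>The inverse substitution carries the ideal of \<open>U(sl2)\<close> back
        into that of the Krawtchouk algebra, where the composite changes \<open>p - q\<close> only
        modulo the ideal.\<close>
      then have "subst (zeta_inv_gen \<omega>) (subst (zeta_gen \<omega>) (p - q)) \<in> relation_ideal ?R"
        using subst_zeta_inv_gen_relations[OF \<omega>] by (rule subst_relation_ideal[rotated])
      moreover have "cls ?R (subst (zeta_inv_gen \<omega>) (subst (zeta_gen \<omega>) (p - q))) = cls ?R (p - q)"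
        by (simp add: subst_subst cls_subst_eq_self zeta_inv_gen_zeta_gen[OF \<omega>] generator_conv_cls)
      ultimately have "p - q \<in> relation_ideal ?R"
        by (metis cls_eq_iff diff_zero)
      then show ?thesis by (simp add: cls_eq_iff)
    qed
    then show ?thesis by (auto simp: inj_on_def Kraw_def presented_sel)
  qed
  \<comment> \<open>This explicit preimage of each class yields both surjectivity and the values of
    the inverse.\<close>
  have eval_inv: "\<zeta> (cls ?R (subst (zeta_inv_gen \<omega>) p)) = cls sl2_relations p" for p
    by (simp add: eval subst_subst cls_subst_eq_self zeta_gen_zeta_inv_gen[OF \<omega>])
  have "cls sl2_relations p \<in> \<zeta> ` carrier (Kraw \<omega>)" for p
    by (rule image_eqI[where f = \<zeta>, OF eval_inv[of p, symmetric]]) (simp add: Kraw_def presented_sel)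
  then have "\<zeta> ` carrier (Kraw \<omega>) = carrier Usl2"
    by (auto simp: eval Kraw_def Usl2_def presented_sel)
  with hom inj show "\<zeta> \<in> alg_iso (Kraw \<omega>) Usl2"
    by (simp add: alg_iso_def bij_betw_def)
  have inv: "inv_into (carrier (Kraw \<omega>)) \<zeta> (cls sl2_relations (var x)) = cls ?R (zeta_inv_gen \<omega> x)"
    for x
    using eval_inv[of "var x"]
    by (intro inv_into_f_eq[OF inj]) (simp_all add: subst_var Kraw_def presented_sel)
  show "inv_into (carrier (Kraw \<omega>)) \<zeta> uE =
        (1 / (1 + \<omega>)) \<odot>\<^bsub>Kraw \<omega>\<^esub> kA \<omega> \<oplus>\<^bsub>Kraw \<omega>\<^esub> (\<omega> / (1 + \<omega>)) \<odot>\<^bsub>Kraw \<omega>\<^esub> kB \<omega>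
          \<ominus>\<^bsub>Kraw \<omega>\<^esub> (1 / (1 + \<omega>)) \<odot>\<^bsub>Kraw \<omega>\<^esub> kC \<omega>"
    "inv_into (carrier (Kraw \<omega>)) \<zeta> uF =
        (1 / (1 - \<omega>)) \<odot>\<^bsub>Kraw \<omega>\<^esub> kA \<omega> \<oplus>\<^bsub>Kraw \<omega>\<^esub> (\<omega> / (1 - \<omega>)) \<odot>\<^bsub>Kraw \<omega>\<^esub> kB \<omega>
          \<oplus>\<^bsub>Kraw \<omega>\<^esub> (1 / (1 - \<omega>)) \<odot>\<^bsub>Kraw \<omega>\<^esub> kC \<omega>"
    "inv_into (carrier (Kraw \<omega>)) \<zeta> uH = 2 \<odot>\<^bsub>Kraw \<omega>\<^esub> kB \<omega>"
    by (simp_all add: generators_cls inv) (simp_all add: zeta_inv_gen_def Kraw_def presented_simps)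
qed

end
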